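(* Let $T\subset\mathbb{R}^3$ be a convex polyhedron satisfying the assumptions in the context. Let $e_{ij}\in\mathcal{E}^+$ and let $\mathbf{p}_{e_{ij}}$ be the basis function of $\mathcal{M}\Lambda^1(T)$ associated with the edge $e_{ij}$. Then $$\mathcal{T}_{\partial T}(\mathbf{p}_{e_{ij}})=\mathcal{T}_{\partial T}(|e_{ij}|\,\tilde W_{ij}).$$
   Context: $T\subset\mathbb{R}^3$ is a (closed) convex polyhedron with vertices $\mathbf{v}_1,\dots,\mathbf{v}_n$. Generalized barycentric coordinates on $T$ are functions $\lambda_1,\dots,\lambda_n$ on $T$, non-negative, with $L(\mathbf{x})=\sum_i L(\mathbf{v}_i)\lambda_i(\mathbf{x})$ for every affine $L$ and all $\mathbf{x}\in T$. Assumption 1: $\lambda_i(\mathbf{v}_j)=\delta_{ij}$; $\lambda_i\in C^1(T)$ (up to the boundary); on each face $f$, the $\lambda_i$ with $\mathbf{v}_i\in f$ restrict to 2D generalized barycentric coordinates of the polygon $f$ which again satisfy the Lagrange property, are $C^1$ on $f$ and are linear on each edge of $f$, while $\lambda_i|_f=0$ if $\mathbf{v}_i\notin f$. Assumption 2: every face $f$ is a triangle or a parallelogram, and if its vertices are $\mathbf{v}_{i_1},\mathbf{v}_{i_2},\dots$ in counterclockwise order seen from outside $T$, $D_{ab}:=(\nabla\lambda_{i_a}\times\nabla\lambda_{i_b})\cdot\mathbf{n}_f|_f$, and $|f|$ is the area, then $D_{12}=D_{23}=D_{31}=\frac1{2|f|}$ for a triangle, and $D_{12}+D_{34}=D_{23}+D_{41}=\frac1{|f|}$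 for a parallelogram. Here $\mathbf{n}_f$ is the unit outward normal on $f$. Whitney 1-forms: $W_{ij}=\lambda_i\nabla\lambda_j-\lambda_j\nabla\lambda_i$. For $i\ne j$, $e_{ij}$ is the directed segment from $\mathbf{v}_i$ to $\mathbf{v}_j$, with length $|e_{ij}|$, and $\boldsymbol{\tau}_{ij}=\mathbf{v}_j-\mathbf{v}_i$. $\mathcal{E}$ is the set of $e_{ij}$ that are edges of $T$ (both directions included), $\mathcal{E}_F$ the set of $e_{ij}$ lying on $\partial T$ but not in $\mathcal{E}$, $\mathcal{E}_I$ the set of remaining $e_{ij}$ (not lying on $\partial T$). $\mathcal{E}^+\subset\mathcal{E}$ contains each edge of $T$ exactly once, with a prefixed direction; $\mathbf{t}_e$ is the unit tangent vector of $e\in\mathcal{E}^+$ in its direction. For $e_{ij}\in\mathcal{E}$, $\mathcal{V}_{ij}$ is the set of all vertices of the two faces sharing $e_{ij}$. For each $e_{ik}\in\mathcal{E}_I$ fix once and for all coefficients $C^{ik}_{ij}$ with $\boldsymbol{\tau}_{ik}=\sum_{j,\,e_{ij}\in\mathcal{E}}C^{ik}_{ij}\boldsymbol{\tau}_{ij}$. For $e_{ij}\in\mathcal{E}$ define $$\tilde W_{ij}=W_{ij}+\tfrac12\Big(\sum_{\mathbf{v}_k\in\mathcal{V}_{ij},\,e_{ik}\in\mathcal{E}_F}W_{ik}-\sum_{\mathbf{v}_k\in\mathcal{V}_{ij},\,e_{jk}\in\mathcal{E}_F}W_{jk}\Big)+\tfrac12\Big(\sum_{k,\,e_{ik}\in\mathcal{E}_I}C^{ik}_{ij}W_{ik}-\sum_{k,\,e_{jk}\in\mathcal{E}_I}C^{jk}_{ji}W_{jk}\Big).$$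 $\mathcal{F}$ is the set of faces of $T$; $\partial f$ is the boundary of $f$ oriented by the right-hand rule with $\mathbf{n}_f$; $e_{ij}\in\partial f$ means that $e_{ij}$ is an edge of $f$ directed according to this orientation. Define $\tilde W_f=\sum_{e_{ij}\in\partial f}\tilde W_{ij}$ and $$\mathcal{M}\Lambda^1(T)=\mathrm{span}\{\nabla\lambda_i,\ 1\le i\le n\}+\mathrm{span}\{\tilde W_f,\ f\in\mathcal{F}\}.$$ It is known that $\mathcal{M}\Lambda^1(T)$ has a (unique) basis $\{\mathbf{p}_e,\ e\in\mathcal{E}^+\}$ with $\mathbf{p}_e\cdot\mathbf{t}_{e'}|_{e'}=1$ if $e'=e$ and $0$ for every other $e'\in\mathcal{E}^+$; $\mathbf{p}_e$ is the basis function associated with $e$. For a vector field $\mathbf{p}$ on $T$ and $f\in\mathcal{F}$, $\mathcal{T}_f(\mathbf{p})$ is the orthogonal projection of $\mathbf{p}|_f$ onto the plane of $f$ (tangential component), and $\mathcal{T}_{\partial T}(\mathbf{p})$ is the collection of $\mathcal{T}_f(\mathbf{p})$ over all $f\in\mathcal{F}$. *)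

theory Defs
  imports "HOL-Analysis.Analysis"
begin

subsection \<open>Polyhedra: vertices, edges, faces\<close>

text \<open>The vertices are indexed by an arbitrary finite type; the directed segment
  \<open>e\<^sub>i\<^sub>j\<close> is encoded as the index pair \<open>(i, j)\<close>. Faces are the facets in the sense of
  the library, i.e. the two-dimensional faces.\<close>

definition convex_polyhedron :: "(real^3) set \<Rightarrow> ('n::finite \<Rightarrow> real^3) \<Rightarrow> bool" where
  "convex_polyhedron T v \<longleftrightarrow>
     polytope T \<and> aff_dim T = 3 \<and> inj v \<and> range v = {x. x extreme_point_of T}"

definition faces :: "(real^3) set \<Rightarrow> (real^3) set set" where
  "faces T = {f. f facet_of T}"

definition E :: "(real^3) set \<Rightarrow> ('n \<Rightarrow> real^3) \<Rightarrow> ('n \<times> 'n) set" where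
  "E T v = {(i, j). i \<noteq> j \<and> closed_segment (v i) (v j) edge_of T}"

definition E_F :: "(real^3) set \<Rightarrow> ('n \<Rightarrow> real^3) \<Rightarrow> ('n \<times> 'n) set" where
  "E_F T v = {(i, j). i \<noteq> j \<and> closed_segment (v i) (v j) \<subseteq> frontier T} - E T v"

definition E_I :: "(real^3) set \<Rightarrow> ('n \<Rightarrow> real^3) \<Rightarrow> ('n \<times> 'n) set" where
  "E_I T v = {(i, j). i \<noteq> j \<and> \<not> closed_segment (v i) (v j) \<subseteq> frontier T}"

text \<open>Indices of all vertices of the faces sharing the edge \<open>e\<^sub>i\<^sub>j\<close>.\<close>

definition V_adj :: "(real^3) set \<Rightarrow> ('n \<Rightarrow> real^3) \<Rightarrow> 'n \<Rightarrow> 'n \<Rightarrow> 'n set" where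
  "V_adj T v i j = {k. \<exists>f\<in>faces T. closed_segment (v i) (v j) \<subseteq> f \<and> v k \<in> f}"

definition tau :: "('n \<Rightarrow> real^3) \<Rightarrow> 'n \<Rightarrow> 'n \<Rightarrow> real^3" where
  "tau v i j = v j - v i"

definition edge_length :: "('n \<Rightarrow> real^3) \<Rightarrow> 'n \<times> 'n \<Rightarrow> real" where
  "edge_length v e = dist (v (fst e)) (v (snd e))"

definition unit_tangent :: "('n \<Rightarrow> real^3) \<Rightarrow> 'n \<times> 'n \<Rightarrow> real^3" where
  "unit_tangent v e = tau v (fst e) (snd e) /\<^sub>R edge_length v e"

definition edge_selection ::
    "(real^3) set \<Rightarrow> ('n \<Rightarrow> real^3) \<Rightarrow> ('n \<times> 'n) set \<Rightarrow> bool" where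
  "edge_selection T v Ep \<longleftrightarrow>
     Ep \<subseteq> E T v \<and> (\<forall>(i, j)\<in>E T v. ((i, j) \<in> Ep) \<noteq> ((j, i) \<in> Ep))"

definition outward_normal :: "(real^3) set \<Rightarrow> (real^3) set \<Rightarrow> real^3" where
  "outward_normal T f = (THE n. norm n = 1 \<and> (\<forall>y\<in>f. \<forall>x\<in>T. n \<bullet> (x - y) \<le> 0))"

text \<open>Right-hand rule: \<open>e\<^sub>i\<^sub>j\<close> is an edge of \<open>f\<close>, and all of \<open>f\<close> lies to its left when
  seen from the tip of the outward normal.\<close>

definition bdry_edges ::
    "(real^3) set \<Rightarrow> ('n \<Rightarrow> real^3) \<Rightarrow> (real^3) set \<Rightarrow> ('n \<times> 'n) set" where
  "bdry_edges T v f =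
     {(i, j). i \<noteq> j \<and> closed_segment (v i) (v j) edge_of f \<and>
        (\<forall>x\<in>f. cross3 (tau v i j) (x - v i) \<bullet> outward_normal T f \<ge> 0)}"

definition ccw_vertices ::
    "(real^3) set \<Rightarrow> ('n \<Rightarrow> real^3) \<Rightarrow> (real^3) set \<Rightarrow> 'n list \<Rightarrow> bool" where
  "ccw_vertices T v f is \<longleftrightarrow>
     distinct is \<and> set is = {k. v k \<in> f} \<and>
     (\<forall>m<length is. (is ! m, is ! (Suc m mod length is)) \<in> bdry_edges T v f)"

definition is_triangle :: "('n \<Rightarrow> real^3) \<Rightarrow> (real^3) set \<Rightarrow> bool" where
  "is_triangle v f \<longleftrightarrow> card {k. v k \<in> f} = 3"

definition is_parallelogram :: "('n \<Rightarrow> real^3) \<Rightarrow> (real^3) set \<Rightarrow> bool" where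
  "is_parallelogram v f \<longleftrightarrow>
     (\<exists>a b c d. distinct [a, b, c, d] \<and> {k. v k \<in> f} = {a, b, c, d} \<and> v b - v a = v c - v d)"

text \<open>Area of a subset of a plane in space: its Lebesgue measure in orthonormal coordinates
  \<open>(u, w)\<close> of the plane, which does not depend on the choice of the coordinates.\<close>

definition planar_area :: "(real^3) set \<Rightarrow> real" where
  "planar_area S =
     (THE A. \<forall>q u w. norm u = 1 \<and> norm w = 1 \<and> u \<bullet> w = 0 \<and>
                S \<subseteq> {q + s *\<^sub>R u + t *\<^sub>R w |s t. True} \<longrightarrow>
                A = measure lebesgue {z :: real^2. q + (z$1) *\<^sub>R u + (z$2) *\<^sub>R w \<in> S})"


subsection \<open>Generalized barycentric coordinates\<close>

text \<open>\<open>C\<^sup>1\<close> up to the boundary, with derivatives taken within \<open>S\<close>. On a planar \<open>S\<close> the gradient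
  field \<open>g\<close> is determined only up to its normal component; only its tangential part matters.\<close>

definition C1_on :: "(real^3) set \<Rightarrow> (real^3 \<Rightarrow> real) \<Rightarrow> bool" where
  "C1_on S u \<longleftrightarrow>
     (\<exists>g. continuous_on S g \<and>
          (\<forall>x\<in>S. (u has_derivative (\<lambda>h. g x \<bullet> h)) (at x within S)))"

text \<open>Used only for \<open>T\<close> a convex body, where the gradient within \<open>T\<close> is unique at every point of
  \<open>T\<close>, also on the boundary.\<close>

definition grad :: "(real^3) set \<Rightarrow> (real^3 \<Rightarrow> real) \<Rightarrow> real^3 \<Rightarrow> real^3" where
  "grad T u x = (SOME g. (u has_derivative (\<lambda>h. g \<bullet> h)) (at x within T))"

text \<open>Affine functions on a face are the restrictions of affine functions on space, so this
  covers both the polyhedron and its polygonal faces.\<close>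

definition gen_barycentric ::
    "(real^3) set \<Rightarrow> 'n set \<Rightarrow> ('n \<Rightarrow> real^3) \<Rightarrow> ('n \<Rightarrow> real^3 \<Rightarrow> real) \<Rightarrow> bool" where
  "gen_barycentric S I v lam \<longleftrightarrow>
     (\<forall>i\<in>I. \<forall>x\<in>S. lam i x \<ge> 0) \<and>
     (\<forall>a b. \<forall>x\<in>S. a \<bullet> x + b = (\<Sum>i\<in>I. (a \<bullet> v i + b) * lam i x))"

definition linear_along :: "(real^3) set \<Rightarrow> (real^3 \<Rightarrow> real) \<Rightarrow> bool" where
  "linear_along e u \<longleftrightarrow>
     (\<forall>x\<in>e. \<forall>y\<in>e. \<forall>t\<in>{0..1}. u ((1 - t) *\<^sub>R x + t *\<^sub>R y) = (1 - t) * u x + t * u y)"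

definition assumption1 ::
    "(real^3) set \<Rightarrow> ('n::finite \<Rightarrow> real^3) \<Rightarrow> ('n \<Rightarrow> real^3 \<Rightarrow> real) \<Rightarrow> bool" where
  "assumption1 T v lam \<longleftrightarrow>
     (\<forall>i j. lam i (v j) = (if i = j then 1 else 0)) \<and>
     (\<forall>i. C1_on T (lam i)) \<and>
     (\<forall>f\<in>faces T.
        gen_barycentric f {i. v i \<in> f} v lam \<and>
        (\<forall>i\<in>{i. v i \<in> f}.
           (\<forall>j\<in>{j. v j \<in> f}. lam i (v j) = (if i = j then 1 else 0)) \<and>
           C1_on f (lam i) \<and>
           (\<forall>e. e edge_of f \<longrightarrow> linear_along e (lam i))) \<and>
        (\<forall>i. v i \<notin> f \<longrightarrow> (\<forall>x\<in>f. lam i x = 0)))"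

definition D ::
    "(real^3) set \<Rightarrow> ('n \<Rightarrow> real^3 \<Rightarrow> real) \<Rightarrow> (real^3) set \<Rightarrow> 'n \<Rightarrow> 'n \<Rightarrow> real^3 \<Rightarrow> real" where
  "D T lam f a b x = cross3 (grad T (lam a) x) (grad T (lam b) x) \<bullet> outward_normal T f"

definition assumption2 ::
    "(real^3) set \<Rightarrow> ('n::finite \<Rightarrow> real^3) \<Rightarrow> ('n \<Rightarrow> real^3 \<Rightarrow> real) \<Rightarrow> bool" where
  "assumption2 T v lam \<longleftrightarrow>
     (\<forall>f\<in>faces T.
        (is_triangle v f \<or> is_parallelogram v f) \<and>
        (\<forall>a b c. ccw_vertices T v f [a, b, c] \<longrightarrow>
           (\<forall>x\<in>f. D T lam f a b x = 1 / (2 * planar_area f) \<and>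
                   D T lam f b c x = 1 / (2 * planar_area f) \<and>
                   D T lam f c a x = 1 / (2 * planar_area f))) \<and>
        (\<forall>a b c d. ccw_vertices T v f [a, b, c, d] \<longrightarrow>
           (\<forall>x\<in>f. D T lam f a b x + D T lam f c d x = 1 / planar_area f \<and>
                   D T lam f b c x + D T lam f d a x = 1 / planar_area f)))"


subsection \<open>Whitney forms and the space of one-forms\<close>

definition W ::
    "(real^3) set \<Rightarrow> ('n \<Rightarrow> real^3 \<Rightarrow> real) \<Rightarrow> 'n \<Rightarrow> 'n \<Rightarrow> real^3 \<Rightarrow> real^3" where
  "W T lam i j x = lam i x *\<^sub>R grad T (lam j) x - lam j x *\<^sub>R grad T (lam i) x"

text \<open>\<open>C i k j\<close> is the coefficient of \<open>\<tau>\<^sub>i\<^sub>j\<close> in the expansion of \<open>\<tau>\<^sub>i\<^sub>k\<close>.\<close>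

definition interior_coeffs ::
    "(real^3) set \<Rightarrow> ('n::finite \<Rightarrow> real^3) \<Rightarrow> ('n \<Rightarrow> 'n \<Rightarrow> 'n \<Rightarrow> real) \<Rightarrow> bool" where
  "interior_coeffs T v C \<longleftrightarrow>
     (\<forall>(i, k)\<in>E_I T v. tau v i k = (\<Sum>j | (i, j) \<in> E T v. C i k j *\<^sub>R tau v i j))"

definition Wt ::
    "(real^3) set \<Rightarrow> ('n::finite \<Rightarrow> real^3) \<Rightarrow> ('n \<Rightarrow> real^3 \<Rightarrow> real) \<Rightarrow>
     ('n \<Rightarrow> 'n \<Rightarrow> 'n \<Rightarrow> real) \<Rightarrow> 'n \<Rightarrow> 'n \<Rightarrow> real^3 \<Rightarrow> real^3" where
  "Wt T v lam C i j x =
     W T lam i j x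
     + (1/2) *\<^sub>R ((\<Sum>k | k \<in> V_adj T v i j \<and> (i, k) \<in> E_F T v. W T lam i k x)
              - (\<Sum>k | k \<in> V_adj T v i j \<and> (j, k) \<in> E_F T v. W T lam j k x))
     + (1/2) *\<^sub>R ((\<Sum>k | (i, k) \<in> E_I T v. C i k j *\<^sub>R W T lam i k x)
              - (\<Sum>k | (j, k) \<in> E_I T v. C j k i *\<^sub>R W T lam j k x))"

definition Wt_face ::
    "(real^3) set \<Rightarrow> ('n::finite \<Rightarrow> real^3) \<Rightarrow> ('n \<Rightarrow> real^3 \<Rightarrow> real) \<Rightarrow>
     ('n \<Rightarrow> 'n \<Rightarrow> 'n \<Rightarrow> real) \<Rightarrow> (real^3) set \<Rightarrow> real^3 \<Rightarrow> real^3" where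
  "Wt_face T v lam C f x = (\<Sum>(i, j)\<in>bdry_edges T v f. Wt T v lam C i j x)"

text \<open>A vector field on \<open>T\<close> is a total function of which only the values on \<open>T\<close> count; spans,
  independence and equality of fields are therefore always taken pointwise on \<open>T\<close>.\<close>

definition MLambda1 ::
    "(real^3) set \<Rightarrow> ('n::finite \<Rightarrow> real^3) \<Rightarrow> ('n \<Rightarrow> real^3 \<Rightarrow> real) \<Rightarrow>
     ('n \<Rightarrow> 'n \<Rightarrow> 'n \<Rightarrow> real) \<Rightarrow> (real^3 \<Rightarrow> real^3) set" where
  "MLambda1 T v lam C =
     {q. \<exists>a c. \<forall>x\<in>T. q x = (\<Sum>i\<in>UNIV. a i *\<^sub>R grad T (lam i) x)
                            + (\<Sum>f\<in>faces T. c f *\<^sub>R Wt_face T v lam C f x)}"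

definition basis_on ::
    "(real^3) set \<Rightarrow> (real^3 \<Rightarrow> real^3) set \<Rightarrow> 'e set \<Rightarrow> ('e \<Rightarrow> real^3 \<Rightarrow> real^3) \<Rightarrow> bool" where
  "basis_on T M I p \<longleftrightarrow>
     (\<forall>e\<in>I. p e \<in> M) \<and>
     (\<forall>c. (\<forall>x\<in>T. (\<Sum>e\<in>I. c e *\<^sub>R p e x) = 0) \<longrightarrow> (\<forall>e\<in>I. c e = 0)) \<and>
     (\<forall>q\<in>M. \<exists>c. \<forall>x\<in>T. q x = (\<Sum>e\<in>I. c e *\<^sub>R p e x))"

definition edge_basis ::
    "(real^3) set \<Rightarrow> ('n::finite \<Rightarrow> real^3) \<Rightarrow> ('n \<Rightarrow> real^3 \<Rightarrow> real) \<Rightarrow>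
     ('n \<Rightarrow> 'n \<Rightarrow> 'n \<Rightarrow> real) \<Rightarrow> ('n \<times> 'n) set \<Rightarrow> ('n \<times> 'n \<Rightarrow> real^3 \<Rightarrow> real^3) \<Rightarrow> bool" where
  "edge_basis T v lam C Ep p \<longleftrightarrow>
     basis_on T (MLambda1 T v lam C) Ep p \<and>
     (\<forall>e\<in>Ep. \<forall>e'\<in>Ep. \<forall>x\<in>closed_segment (v (fst e')) (v (snd e')).
        p e x \<bullet> unit_tangent v e' = (if e' = e then 1 else 0))"


subsection \<open>Tangential traces\<close>

definition tang_trace ::
    "(real^3) set \<Rightarrow> (real^3) set \<Rightarrow> (real^3 \<Rightarrow> real^3) \<Rightarrow> real^3 \<Rightarrow> real^3" where
  "tang_trace T f p =
     restrict (\<lambda>x. p x - (p x \<bullet> outward_normal T f) *\<^sub>R outward_normal T f) f"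

definition bdry_tang_trace ::
    "(real^3) set \<Rightarrow> (real^3 \<Rightarrow> real^3) \<Rightarrow> (real^3) set \<Rightarrow> real^3 \<Rightarrow> real^3" where
  "bdry_tang_trace T p = restrict (\<lambda>f. tang_trace T f p) (faces T)"

end

theory Submission
  imports Defs
begin

text \<open>On a facet \<open>f\<close>, the coordinates of the vertices off \<open>f\<close> vanish together with their
  tangential gradients. Hence the tangential trace of \<open>Wt i j\<close> on \<open>f\<close> is \<open>0\<close> unless \<open>f\<close> contains
  the edge; it is that of \<open>W i j\<close> if \<open>f\<close> is a triangle containing the edge, and that of
  \<open>W i j + (W i k - W j l) / 2\<close> if \<open>f\<close> is a parallelogram with vertices \<open>i, j, k, l\<close> in cyclic order.
  Since the coordinates sum to \<open>1\<close> on \<open>f\<close>, summing these traces over the edges ending in \<open>k\<close> gives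
  the trace of \<open>grad (lam k)\<close>. So every field of the space has on all facets at once the trace
  of a single combination of the \<open>Wt i j\<close>. The coefficients are read off by evaluating along an
  edge at its initial vertex, where \<open>Wt\<close> is dual to the edge vectors \<open>tau\<close>; for a basis field
  only one edge survives.

  Tangential components at \<open>x \<in> f\<close> are tested against the vectors \<open>y - x\<close> with \<open>y \<in> f\<close>, which span
  the plane of the facet.\<close>

section \<open>Facets of a convex body in space\<close>

text \<open>Also applies to facets, which have empty interior: convexity keeps the segment in
  \<open>S\<close>, and the chain rule with uniqueness of one-sided derivatives on
  \<open>{0..1}\<close> gives the slope.\<close>

lemma directional_derivative_affine:
  fixes u :: "'a::real_normed_vector \<Rightarrow> real"
  assumes S: "convex S" "x \<in> S" "y \<in> S"
    and der: "(u has_derivative u') (at x within S)"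
    and aff: "\<And>t. t \<in> {0..1} \<Longrightarrow> u ((1 - t) *\<^sub>R x + t *\<^sub>R y) = (1 - t) * u x + t * u y"
  shows "u' (y - x) = u y - u x"
proof -
  define g where "g t = (1 - t) *\<^sub>R x + t *\<^sub>R y" for t :: real
  have g: "(g has_derivative (\<lambda>h. h *\<^sub>R (y - x))) (at 0 within {0..1})"
    unfolding g_def by (auto intro!: derivative_eq_intros simp: algebra_simps)
  have "g ` {0..1} \<subseteq> S"
    using S by (auto simp: g_def convex_alt)
  moreover have "g 0 = x" by (simp add: g_def)
  ultimately have "(u has_derivative u') (at (g 0) within g ` {0..1})"
    using der has_derivative_subset by auto
  from has_derivative_in_compose[OF g this]
  have "((\<lambda>t. u (g t)) has_derivative (\<lambda>h. h *\<^sub>R u' (y - x))) (at 0 within {0..1})"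
    using linear_cmul[OF has_derivative_linear[OF der]] by simp
  then have "((\<lambda>t. u (g t)) has_vector_derivative u' (y - x)) (at 0 within {0..1})"
    by (simp add: has_vector_derivative_def)
  then have 1: "((\<lambda>t. (1 - t) * u x + t * u y) has_vector_derivative u' (y - x)) (at 0 within {0..1})"
    by (rule has_vector_derivative_transform[rotated 2]) (auto simp: aff g_def)
  have 2: "((\<lambda>t. (1 - t) * u x + t * u y) has_vector_derivative (u y - u x)) (at 0 within {0..1})"
    unfolding has_vector_derivative_def by (auto intro!: derivative_eq_intros simp: algebra_simps)
  show ?thesis
    using vector_derivative_unique_within_closed_interval[of 0 1 0] 1 2 by auto
qed

text \<open>By dimension, the affine hull of \<open>f\<close> is the whole plane through
  \<open>x\<close> with normal \<open>n\<close>. The tangential part \<open>w\<close> of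
  \<open>z\<close> is a direction of this plane, hence orthogonal to \<open>z\<close> and so to
  itself.\<close>

lemma orthogonal_facet:
  fixes f :: "(real^3) set"
  assumes f: "aff_dim f = 2" and n: "norm n = 1" "\<And>y z. y \<in> f \<Longrightarrow> z \<in> f \<Longrightarrow> n \<bullet> (y - z) = 0"
    and x: "x \<in> f" and z: "\<And>y. y \<in> f \<Longrightarrow> z \<bullet> (y - x) = 0"
  shows "z = (z \<bullet> n) *\<^sub>R n"
proof -
  have "n \<noteq> 0" using n by auto
  have sub: "affine hull f \<subseteq> {y. n \<bullet> y = n \<bullet> x}"
    using n(2)[OF _ x] by (intro hull_minimal) (auto simp: inner_diff_right affine_hyperplane)
  have hull: "affine hull f = {y. n \<bullet> y = n \<bullet> x}"
    by (rule affine_dim_equal)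
      (use sub f x \<open>n \<noteq> 0\<close> in \<open>auto simp: affine_hyperplane\<close>)
  have sub: "affine hull f \<subseteq> {y. z \<bullet> y = z \<bullet> x}"
    using z by (intro hull_minimal) (auto simp: inner_diff_right affine_hyperplane)
  have nn: "n \<bullet> n = 1" using n by (simp add: dot_square_norm)
  define w where "w = z - (z \<bullet> n) *\<^sub>R n"
  have wn: "n \<bullet> w = 0" using nn by (simp add: w_def inner_diff_right inner_commute)
  then have "x + w \<in> affine hull f" by (simp add: hull inner_add_right)
  with sub have "z \<bullet> w = 0" by (auto simp: inner_add_right)
  then have "w \<bullet> w = 0" using wn by (simp add: w_def inner_diff_left)
  then show ?thesis by (simp add: w_def)
qed

text \<open>Makes the \<open>THE\<close> in \<open>outward_normal\<close> usable. A supporting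
  halfspace cutting out \<open>f\<close> gives existence. Any candidate is orthogonal to the facet,
  hence plus or minus \<open>n\<close>, and the minus sign would squeeze \<open>T\<close> into a
  plane.\<close>

lemma outward_normal_facet:
  assumes T: "polyhedron T" "aff_dim T = 3" and f: "f facet_of T"
  shows norm_outward_normal: "norm (outward_normal T f) = 1"
    and outward_normal_orthogonal: "\<And>y z. y \<in> f \<Longrightarrow> z \<in> f \<Longrightarrow> outward_normal T f \<bullet> (y - z) = 0"
proof -
  let ?P = "\<lambda>n. norm n = 1 \<and> (\<forall>y\<in>f. \<forall>x\<in>T. n \<bullet> (x - y) \<le> 0)"
  have dim: "aff_dim f = 2" and fT: "f \<subseteq> T" and "f \<noteq> {}"
    using f T by (auto simp: facet_of_def face_of_imp_subset)
  obtain a b where a: "a \<noteq> 0" "T \<subseteq> {x. a \<bullet> x \<le> b}" "f = T \<inter> {x. a \<bullet> x = b}"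
    using facet_of_polyhedron[OF T(1) f] by blast
  define n where "n = a /\<^sub>R norm a"
  have n: "?P n"
    using a by (auto simp: n_def inner_diff_right divide_simps)
  have orth: "m \<bullet> (y - z) = 0" if "?P m" "y \<in> f" "z \<in> f" for m y z
    using that fT by (smt (verit) inner_diff_right subsetD)
  have uniq: "m = n" if m: "?P m" for m
  proof -
    obtain y where y: "y \<in> f" using \<open>f \<noteq> {}\<close> by auto
    have eq: "m = (m \<bullet> n) *\<^sub>R n"
      by (rule orthogonal_facet[OF dim _ _ y]) (use n m orth y in blast)+
    then have "\<bar>m \<bullet> n\<bar> = 1" using m n by (metis mult.right_neutral norm_scaleR)
    moreover have "m \<bullet> n \<noteq> - 1"
    proof
      assume "m \<bullet> n = - 1"
      with eq have mn: "m = - n" by simp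
      have "T \<subseteq> {x. n \<bullet> x = n \<bullet> y}"
        using m n y unfolding mn by (fastforce simp: inner_diff_right)
      from aff_dim_subset[OF this] have "aff_dim T \<le> 2"
        using n by (subst (asm) aff_dim_hyperplane) auto
      then show False using T by simp
    qed
    ultimately show "m = n" using eq by (metis abs_eq_iff' abs_1 scaleR_one)
  qed
  have "outward_normal T f = n"
    unfolding outward_normal_def by (rule the_equality) (use n uniq in blast)+
  then show "norm (outward_normal T f) = 1"
    and "\<And>y z. y \<in> f \<Longrightarrow> z \<in> f \<Longrightarrow> outward_normal T f \<bullet> (y - z) = 0"
    using n orth[OF n] by simp_all
qed

text \<open>A side is an exposed face: a suitable linear functional attains its minimum over the
  parallelogram exactly there.\<close>

lemma parallelogram_edge:
  fixes a b c d :: "'a::euclidean_space"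
  assumes par: "b - a = c - d" and dim: "aff_dim {a, b, c, d} = 2"
  shows "closed_segment a b face_of convex hull {a, b, c, d}"
proof -
  define u where "u = b - a"
  define w where "w = d - a"
  \<comment> \<open>Up to the factor \<open>u \<bullet> u\<close>, this is the component of
    \<open>w\<close> orthogonal to \<open>u\<close>. As a functional it is constant along the side
    and, once \<open>h\<close> is known to be nonzero, larger at \<open>c\<close> and
    \<open>d\<close>.\<close>
  define h where "h = (u \<bullet> u) *\<^sub>R w - (w \<bullet> u) *\<^sub>R u"
  have bcd: "b = a + u" "d = a + w" "c = a + u + w"
    using par by (auto simp: u_def w_def algebra_simps)
  have hu: "h \<bullet> u = 0"
    by (simp add: h_def inner_diff_left)
  have hh: "h \<bullet> h = (u \<bullet> u) * (h \<bullet> w)"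
    using hu by (subst (2) h_def) (simp add: inner_diff_right)
  have ncol: "\<not> collinear {a, b, c, d}"
    using dim by (simp add: collinear_aff_dim)
  have u0: "u \<noteq> 0"
  proof
    assume "u = 0"
    then have "{a, b, c, d} = {a, d}" by (auto simp: bcd)
    with ncol show False by simp
  qed
  have "h \<noteq> 0"
  proof
    assume "h = 0"
    then have "(1 / (u \<bullet> u)) *\<^sub>R (u \<bullet> u) *\<^sub>R w = (1 / (u \<bullet> u)) *\<^sub>R (w \<bullet> u) *\<^sub>R u"
      by (simp add: h_def)
    then have w: "w = ((w \<bullet> u) / (u \<bullet> u)) *\<^sub>R u"
      using u0 by simp
    have "collinear {a, b, c, d}"
      unfolding collinear_def
    proof (rule exI[of _ u], intro ballI)
      fix x y assume xy: "x \<in> {a, b, c, d}" "y \<in> {a, b, c, d}"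
      obtain s where s: "w = s *\<^sub>R u" using w by blast
      have *: "\<exists>t. z = a + t *\<^sub>R u" if "z \<in> {a, b, c, d}" for z
        using that unfolding bcd s
        by (auto intro: exI[of _ 0] exI[of _ 1] exI[of _ s] exI[of _ "1 + s"] simp: algebra_simps)
      obtain t t' where "x = a + t *\<^sub>R u" "y = a + t' *\<^sub>R u" using *[OF xy(1)] *[OF xy(2)] by blast
      then have "x - y = (t - t') *\<^sub>R u" by (simp add: algebra_simps)
      then show "\<exists>c. x - y = c *\<^sub>R u" by blast
    qed
    with ncol show False ..
  qed
  then have hw: "h \<bullet> w > 0"
    using hh u0 by (metis inner_gt_zero_iff zero_less_mult_pos)
  let ?F = "convex hull {a, b, c, d} \<inter> {x. h \<bullet> x = h \<bullet> a}"
  have "convex hull {a, b, c, d} \<subseteq> {x. h \<bullet> x \<ge> h \<bullet> a}"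
    by (rule hull_minimal)
      (use hu hw in \<open>auto simp: bcd inner_add_right convex_halfspace_ge\<close>)
  then have F: "?F face_of convex hull {a, b, c, d}"
    by (intro face_of_Int_supporting_hyperplane_ge) auto
  \<comment> \<open>A face of the hull of finitely many points is the hull of some of them; only
    \<open>a\<close> and \<open>b\<close> attain the minimum.\<close>
  then obtain S where S: "S \<subseteq> {a, b, c, d}" "?F = convex hull S"
    by (rule face_of_convex_hull_subset[rotated]) (auto intro: finite_imp_compact)
  have "S \<subseteq> {a, b}"
  proof
    fix s assume s: "s \<in> S"
    then have "s \<in> ?F" using S hull_subset by fastforce
    then have "h \<bullet> s = h \<bullet> a" by simp
    then show "s \<in> {a, b}" using s S(1) hu hw by (auto simp: bcd inner_add_right)
  qed
  then have 1: "?F \<subseteq> closed_segment a b"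
    unfolding S(2) segment_convex_hull by (rule hull_mono)
  have "{a, b} \<subseteq> ?F"
    using hu by (auto simp: bcd inner_add_right intro: hull_inc)
  then have 2: "closed_segment a b \<subseteq> ?F"
    unfolding segment_convex_hull
    by (rule hull_minimal) (auto intro: convex_Int convex_convex_hull convex_hyperplane)
  show ?thesis using F 1 2 by (metis subset_antisym)
qed

lemma sum_of_bool_diff:
  fixes g :: "'a \<Rightarrow> real"
  assumes "finite S" "p \<in> S" "q \<in> S"
  shows "(\<Sum>e\<in>S. g e * (of_bool (e = p) - of_bool (e = q))) = g p - g q"
proof -
  have "g e * (of_bool (e = p) - of_bool (e = q)) = (if e = p then g e else 0) - (if e = q then g e else 0)"
    for e by simp
  then show ?thesis using assms by (simp add: sum_subtractf)
qed

section \<open>Vertices and edges\<close>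

locale barycentric_polyhedron =
  fixes T :: "(real^3) set" and v :: "'n::finite \<Rightarrow> real^3" and lam :: "'n \<Rightarrow> real^3 \<Rightarrow> real"
    and C :: "'n \<Rightarrow> 'n \<Rightarrow> 'n \<Rightarrow> real"
  assumes polyhedron: "convex_polyhedron T v"
    and lam1: "assumption1 T v lam"
    and lam2: "assumption2 T v lam"
begin

lemma polytope_T: "polytope T" and aff_dim_T: "aff_dim T = 3" and inj_v: "inj v"
  and extreme_v: "range v = {x. x extreme_point_of T}"
  using polyhedron by (auto simp: convex_polyhedron_def)

lemma v_eq_iff [simp]: "v i = v j \<longleftrightarrow> i = j"
  using inj_v by (auto dest: injD)

lemma v_extreme: "v k extreme_point_of T"
  using extreme_v by auto

lemma v_in_T: "v k \<in> T"
  using v_extreme by (simp add: extreme_point_of_def)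

lemma facetD:
  assumes "f \<in> faces T"
  shows "f facet_of T" "f face_of T" "f \<subseteq> T" "aff_dim f = 2" "polytope f" "convex f"
proof -
  show f: "f facet_of T" using assms by (simp add: faces_def)
  then show "f face_of T" "f \<subseteq> T" by (auto simp: facet_of_imp_face_of facet_of_imp_subset)
  show "aff_dim f = 2" using f aff_dim_T by (simp add: facet_of_def)
  show "polytope f" using polytope_T \<open>f face_of T\<close> face_of_polytope_polytope by blast
  then show "convex f" by (rule polytope_imp_convex)
qed

lemma finite_faces: "finite (faces T)"
  using finite_polytope_facets[OF polytope_T] by (simp add: faces_def)

lemma segment_subset_facet:
  "f \<in> faces T \<Longrightarrow> closed_segment (v i) (v j) \<subseteq> f \<longleftrightarrow> v i \<in> f \<and> v j \<in> f"
  using facetD(6) closed_segment_subset by (metis ends_in_segment subsetD)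

lemma E_commute: "(i, j) \<in> E T v \<longleftrightarrow> (j, i) \<in> E T v"
  by (auto simp: E_def closed_segment_commute)

lemma E_irrefl: "(i, j) \<in> E T v \<Longrightarrow> i \<noteq> j"
  by (auto simp: E_def)

lemma facet_subset_frontier: "f \<in> faces T \<Longrightarrow> f \<subseteq> frontier T"
  using face_of_disjoint_interior[OF facetD(2)] facetD(3,4) aff_dim_T
    polytope_imp_closed[OF polytope_T]
  by (fastforce simp: frontier_def)

lemma E_F_iff_in_facet:
  assumes "f \<in> faces T" "v i \<in> f" "v k \<in> f" "i \<noteq> k"
  shows "(i, k) \<in> E_F T v \<longleftrightarrow> (i, k) \<notin> E T v"
proof -
  have "closed_segment (v i) (v k) \<subseteq> frontier T"
    using assms segment_subset_facet facet_subset_frontier by (meson subset_trans)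
  then show ?thesis using assms by (auto simp: E_F_def)
qed

lemma E_I_not_in_facet:
  assumes "f \<in> faces T" "(i, k) \<in> E_I T v" shows "v i \<notin> f \<or> v k \<notin> f"
  using assms segment_subset_facet facet_subset_frontier unfolding E_I_def by blast

lemma E_subset_facet:
  assumes "(i, j) \<in> E T v"
  obtains f where "f \<in> faces T" "v i \<in> f" "v j \<in> f"
proof -
  let ?e = "closed_segment (v i) (v j)"
  have e: "?e face_of T" "aff_dim ?e = 1"
    using assms by (auto simp: E_def edge_of_def)
  then have "?e \<noteq> T" using aff_dim_T by auto
  then obtain f where "f facet_of T" "?e \<subseteq> f"
    using face_of_polyhedron_subset_facet[OF polytope_imp_polyhedron[OF polytope_T] e(1)] by auto
  then show thesis using that by (auto simp: faces_def)
qed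

lemma E_edge_of_facet:
  assumes "f \<in> faces T" "v i \<in> f" "v j \<in> f" "(i, j) \<in> E T v"
  shows "closed_segment (v i) (v j) edge_of f"
  using assms face_of_face[OF facetD(2)] segment_subset_facet
  by (auto simp: E_def edge_of_def)

lemma E_if_face_of_facet:
  assumes "f \<in> faces T" "closed_segment (v i) (v j) face_of f" "i \<noteq> j"
  shows "(i, j) \<in> E T v"
  using assms face_of_trans[OF assms(2) facetD(2)[OF assms(1)]]
  by (auto simp: E_def edge_of_def segment_convex_hull aff_dim_convex_hull aff_dim_2)

lemma bdry_edges_subset_E: "f \<in> faces T \<Longrightarrow> bdry_edges T v f \<subseteq> E T v"
  by (auto simp: bdry_edges_def edge_of_def intro: E_if_face_of_facet)

text \<open>Distinct facets meet in a face of dimension below 2, which is a segment. Vertices of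
  \<open>T\<close> in it are extreme points of it, so two different ones are its ends.\<close>

lemma E_if_in_two_facets:
  assumes f: "f \<in> faces T" "f' \<in> faces T" "f \<noteq> f'"
    and ik: "i \<noteq> k" "v i \<in> f" "v k \<in> f" "v i \<in> f'" "v k \<in> f'"
  shows "(i, k) \<in> E T v"
proof -
  let ?g = "f \<inter> f'"
  have gT: "?g face_of T" using f facetD(2) face_of_Int by blast
  then have gf: "?g face_of f" "?g face_of f'"
    using face_of_face[OF facetD(2)] f by blast+
  have "?g \<noteq> f"
  proof
    assume "?g = f"
    then have "f face_of f'" using gf by simp
    then have "aff_dim f < aff_dim f'" using face_of_aff_dim_lt facetD(6) f by blast
    then show False using facetD(4) f by simp
  qed
  then have "aff_dim ?g < 2"
    using face_of_aff_dim_lt[OF _ gf(1)] facetD f by metis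
  then have "collinear ?g" by (simp add: collinear_aff_dim)
  moreover have "compact ?g" "convex ?g"
    using gT polytope_T face_of_polytope_polytope polytope_imp_compact polytope_imp_convex
    by blast+
  ultimately obtain a b where ab: "?g = closed_segment a b"
    using compact_convex_collinear_segment[of ?g] ik by blast
  have "v i extreme_point_of ?g" "v k extreme_point_of ?g"
    using extreme_point_of_face[OF gT] v_extreme ik by auto
  then have "v i \<in> {a, b}" "v k \<in> {a, b}"
    unfolding ab by (auto simp: extreme_point_of_segment)
  then have "?g = closed_segment (v i) (v k)"
    using ik(1) ab v_eq_iff[of i k] closed_segment_commute[of a b] by auto
  then show ?thesis using gf E_if_face_of_facet f ik by metis
qed

section \<open>Sides and diagonals of triangular and parallelogram facets\<close>

lemma facet_eq_hull:
  assumes "f \<in> faces T" shows "f = convex hull (v ` {k. v k \<in> f})"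
proof -
  have "{x. x extreme_point_of f} = v ` {k. v k \<in> f}"
    using extreme_point_of_face[OF facetD(2)[OF assms]] extreme_v by auto
  then show ?thesis
    using Krein_Milman_Minkowski[of f] facetD[OF assms] polytope_imp_compact by metis
qed

text \<open>Three points whose hull has dimension 2 are affinely independent, and then every subset
  of them spans a face.\<close>

lemma triangle_E:
  assumes f: "f \<in> faces T" and "is_triangle v f" and ij: "v i \<in> f" "v j \<in> f" "i \<noteq> j"
  shows "(i, j) \<in> E T v"
proof -
  let ?S = "v ` {k. v k \<in> f}"
  have hull: "convex hull ?S = f" using facet_eq_hull[OF f] by simp
  have "card ?S = 3"
    using assms inj_on_subset[OF inj_v] by (subst card_image) (auto simp: is_triangle_def)
  moreover have "aff_dim ?S = 2"
    using facetD(4)[OF f] hull aff_dim_convex_hull[of ?S] by simp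
  ultimately have "\<not> affine_dependent ?S"
    by (simp add: affine_independent_iff_card)
  then have "convex hull {v i, v j} face_of convex hull ?S"
    using ij by (subst face_of_convex_hull_affine_independent) (auto intro!: exI[of _ "{v i, v j}"])
  then show ?thesis
    using E_if_face_of_facet[OF f] ij by (simp add: hull segment_convex_hull)
qed

text \<open>The diagonals bisect each other. If one were a face, it would contain an inner point of
  the other and hence its end \<open>v b\<close>, which would be an extreme point of that segment
  other than its two ends.\<close>

lemma parallelogram_E:
  assumes f: "f \<in> faces T" and dist: "distinct [a, b, c, d]"
    and K: "{k. v k \<in> f} = {a, b, c, d}" and par: "v b - v a = v c - v d"
  shows "(a, b) \<in> E T v" and "(a, c) \<notin> E T v"
proof -
  have hull: "convex hull {v a, v b, v c, v d} = f"
    using facet_eq_hull[OF f] by (simp add: K)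
  then have "aff_dim {v a, v b, v c, v d} = 2"
    using facetD(4)[OF f] aff_dim_convex_hull[of "{v a, v b, v c, v d}"] by simp
  then show "(a, b) \<in> E T v"
    using parallelogram_edge[OF par] E_if_face_of_facet[OF f] dist by (simp add: hull)
  show "(a, c) \<notin> E T v"
  proof
    assume "(a, c) \<in> E T v"
    then have ac: "closed_segment (v a) (v c) face_of T" by (simp add: E_def edge_of_def)
    have bd: "v b \<in> T" "v d \<in> T" by (rule v_in_T)+
    have "midpoint (v b) (v d) = midpoint (v a) (v c)"
      using par by (simp add: midpoint_def algebra_simps)
    moreover have "midpoint (v b) (v d) \<in> open_segment (v b) (v d)"
      using dist by simp
    ultimately have "v b \<in> closed_segment (v a) (v c)"
      using ac bd midpoint_in_closed_segment[of "v a" "v c"] unfolding face_of_def by metis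
    then have "v b extreme_point_of closed_segment (v a) (v c)"
      using extreme_point_of_face[OF ac] v_extreme by blast
    then show False using dist by (auto simp: extreme_point_of_segment)
  qed
qed

section \<open>Tangential traces of the Whitney forms\<close>

lemma has_derivative_lam:
  assumes "x \<in> T"
  shows "(lam i has_derivative (\<lambda>h. grad T (lam i) x \<bullet> h)) (at x within T)"
proof -
  obtain g where "(lam i has_derivative (\<lambda>h. g x \<bullet> h)) (at x within T)"
    using lam1 assms unfolding assumption1_def C1_on_def by blast
  then show ?thesis
    unfolding grad_def by (rule someI)
qed

lemma has_derivative_lam_facet:
  assumes "f \<in> faces T" "x \<in> f"
  shows "(lam i has_derivative (\<lambda>h. grad T (lam i) x \<bullet> h)) (at x within f)"
  using has_derivative_subset[OF has_derivative_lam facetD(3)] facetD(3) assms by blast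

lemma lam_vertex: "lam i (v j) = (if i = j then 1 else 0)"
  using lam1 by (simp add: assumption1_def)

lemma lam_outside: "f \<in> faces T \<Longrightarrow> v i \<notin> f \<Longrightarrow> x \<in> f \<Longrightarrow> lam i x = 0"
  using lam1 by (simp add: assumption1_def)

text \<open>The coordinate vanishes on the whole segment from \<open>x\<close> to \<open>y\<close>,
  which stays in \<open>f\<close>.\<close>

lemma grad_lam_outside:
  assumes "f \<in> faces T" "v i \<notin> f" "x \<in> f" "y \<in> f"
  shows "grad T (lam i) x \<bullet> (y - x) = 0"
proof -
  have "lam i ((1 - t) *\<^sub>R x + t *\<^sub>R y) = 0" if "t \<in> {0..1}" for t
    using that assms facetD(6)[of f] by (intro lam_outside) (auto simp: convex_alt)
  then show ?thesis
    using directional_derivative_affine[OF facetD(6)[OF assms(1)] assms(3,4)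
        has_derivative_lam_facet[OF assms(1,3)]] assms lam_outside by simp
qed

lemma sum_lam:
  assumes "f \<in> faces T" "x \<in> f"
  shows "(\<Sum>i | v i \<in> f. lam i x) = 1"
proof -
  have "gen_barycentric f {i. v i \<in> f} v lam"
    using lam1 assms by (simp add: assumption1_def)
  \<comment> \<open>The reproduced affine function is the constant 1.\<close>
  then have "0 \<bullet> x + 1 = (\<Sum>i | v i \<in> f. (0 \<bullet> v i + 1) * lam i x)"
    using assms unfolding gen_barycentric_def by blast
  then show ?thesis by simp
qed

lemma sum_grad_lam:
  assumes "f \<in> faces T" "x \<in> f" "y \<in> f"
  shows "(\<Sum>i | v i \<in> f. grad T (lam i) x \<bullet> (y - x)) = 0"
proof -
  let ?u = "\<lambda>x. \<Sum>i | v i \<in> f. lam i x"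
  have "?u ((1 - t) *\<^sub>R x + t *\<^sub>R y) = 1" if "t \<in> {0..1}" for t
    using that assms facetD(6)[of f] by (intro sum_lam) (auto simp: convex_alt)
  moreover have "(?u has_derivative (\<lambda>h. \<Sum>i | v i \<in> f. grad T (lam i) x \<bullet> h)) (at x within f)"
    using has_derivative_lam_facet assms by (intro has_derivative_sum) auto
  ultimately show ?thesis
    using directional_derivative_affine[of f x y ?u "\<lambda>h. \<Sum>i | v i \<in> f. grad T (lam i) x \<bullet> h"]
      assms facetD(6) sum_lam by simp
qed

text \<open>In a facet containing the edge, the coordinate is either linear along the edge or, for a
  vertex off the facet, zero.\<close>

lemma grad_lam_edge:
  assumes ab: "(a, b) \<in> E T v"
  shows "grad T (lam m) (v a) \<bullet> (v b - v a) = lam m (v b) - lam m (v a)"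
proof -
  obtain f where f: "f \<in> faces T" "v a \<in> f" "v b \<in> f"
    using E_subset_facet[OF ab] .
  show ?thesis
  proof (cases "v m \<in> f")
    case True
    then have "linear_along (closed_segment (v a) (v b)) (lam m)"
      using lam1 f E_edge_of_facet[OF f ab] unfolding assumption1_def by blast
    then show ?thesis
      unfolding linear_along_def
      by (intro directional_derivative_affine[OF facetD(6) _ _ has_derivative_lam_facet])
        (use f in auto)
  next
    case False
    then show ?thesis using f grad_lam_outside lam_outside by simp
  qed
qed

section \<open>Whitney forms at vertices and on facets\<close>

lemma W_swap: "W T lam j i x = - W T lam i j x"
  by (simp add: W_def)

lemma W_outside:
  assumes "f \<in> faces T" "x \<in> f" "y \<in> f" "v i \<notin> f \<or> v j \<notin> f"
  shows "W T lam i j x \<bullet> (y - x) = 0"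
  using assms(4) lam_outside[OF assms(1) _ assms(2)] grad_lam_outside[OF assms(1) _ assms(2,3)]
  by (auto simp: W_def inner_diff_left)

text \<open>At \<open>v a\<close> only \<open>lam a\<close> is nonzero, and along the edge the
  gradients have slope 1 for \<open>b\<close>, -1 for \<open>a\<close> and 0 otherwise.\<close>

lemma W_vertex:
  assumes "(a, b) \<in> E T v"
  shows "W T lam i j (v a) \<bullet> (v b - v a) = of_bool ((i, j) = (a, b)) - of_bool ((j, i) = (a, b))"
  using E_irrefl[OF assms] by (auto simp: W_def inner_diff_left grad_lam_edge[OF assms] lam_vertex)

lemma V_adj_commute: "V_adj T v i j = V_adj T v j i"
  by (simp add: V_adj_def closed_segment_commute)

lemma Wt_swap: "Wt T v lam C j i x = - Wt T v lam C i j x"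
  unfolding Wt_def V_adj_commute[of j i] W_swap[of j i]
  by (simp only: minus_add minus_diff_eq scaleR_minus_right[symmetric] ac_simps)

text \<open>The correction terms carry only pairs from \<open>E_F\<close> and \<open>E_I\<close>,
  which are edges in neither direction, so \<open>W_vertex\<close> makes them vanish here.\<close>

lemma Wt_vertex:
  assumes ab: "(a, b) \<in> E T v"
  shows "Wt T v lam C i j (v a) \<bullet> (v b - v a) = of_bool ((i, j) = (a, b)) - of_bool ((j, i) = (a, b))"
proof -
  have ba: "(b, a) \<in> E T v" using ab E_commute by blast
  have F: "W T lam i k (v a) \<bullet> (v b - v a) = 0" if "(i, k) \<in> E_F T v" for i k
    using that ab ba by (auto simp: W_vertex[OF ab] E_F_def)
  have I: "W T lam i k (v a) \<bullet> (v b - v a) = 0" if "(i, k) \<in> E_I T v" for i k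
  proof -
    have "closed_segment (v a) (v b) \<subseteq> frontier T"
      using E_subset_facet[OF ab] segment_subset_facet facet_subset_frontier by (metis subset_trans)
    then show ?thesis
      using that by (auto simp: W_vertex[OF ab] E_I_def closed_segment_commute)
  qed
  have "Wt T v lam C i j (v a) \<bullet> (v b - v a) = W T lam i j (v a) \<bullet> (v b - v a)"
    by (simp add: Wt_def inner_add_left inner_diff_left inner_sum_left F I)
  then show ?thesis by (simp only: W_vertex[OF ab])
qed

text \<open>A diagonal lies in a single facet. Hence, if it lies in \<open>f\<close>, the restriction to \<open>V_adj\<close>
  admits it only when \<open>f\<close> itself contains the edge.\<close>

lemma sum_V_adj_inner:
  assumes f: "f \<in> faces T" "x \<in> f" "y \<in> f"
  shows "(\<Sum>k | k \<in> V_adj T v i j \<and> (i, k) \<in> E_F T v. W T lam i k x \<bullet> (y - x)) =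
    (if v i \<in> f \<and> v j \<in> f then \<Sum>k | v k \<in> f \<and> (i, k) \<in> E_F T v. W T lam i k x \<bullet> (y - x) else 0)"
proof (cases "v i \<in> f \<and> v j \<in> f")
  case True
  then have "closed_segment (v i) (v j) \<subseteq> f" using segment_subset_facet f by blast
  then have "(\<Sum>k | k \<in> V_adj T v i j \<and> (i, k) \<in> E_F T v. W T lam i k x \<bullet> (y - x)) =
    (\<Sum>k | v k \<in> f \<and> (i, k) \<in> E_F T v. W T lam i k x \<bullet> (y - x))"
    using f W_outside[OF f] by (intro sum.mono_neutral_right) (auto simp: V_adj_def)
  with True show ?thesis by simp
next
  case False
  have "W T lam i k x \<bullet> (y - x) = 0" if k: "k \<in> V_adj T v i j" "(i, k) \<in> E_F T v" for k
  proof (rule ccontr)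
    assume "W T lam i k x \<bullet> (y - x) \<noteq> 0"
    then have ik: "v i \<in> f" "v k \<in> f" using W_outside[OF f] by blast+
    obtain f' where f': "f' \<in> faces T" "closed_segment (v i) (v j) \<subseteq> f'" "v k \<in> f'"
      using k by (auto simp: V_adj_def)
    then have "v i \<in> f'" "v j \<in> f'" by auto
    then have "(i, k) \<in> E T v"
      using E_if_in_two_facets[of f f' i k] f f' ik False k by (auto simp: E_F_def)
    then show False using k by (simp add: E_F_def)
  qed
  then show ?thesis unfolding if_not_P[OF False] by (intro sum.neutral) blast
qed

text \<open>An interior segment has an end off \<open>f\<close>, so its terms have no tangential
  trace there. If the edge is not in \<open>f\<close>, neither does \<open>W\<close>.\<close>

lemma Wt_facet:
  assumes f: "f \<in> faces T" "x \<in> f" "y \<in> f" and ij: "(i, j) \<in> E T v"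
  shows "Wt T v lam C i j x \<bullet> (y - x) =
    (if v i \<in> f \<and> v j \<in> f
     then W T lam i j x \<bullet> (y - x)
        + ((\<Sum>k | v k \<in> f \<and> (i, k) \<in> E_F T v. W T lam i k x \<bullet> (y - x))
           - (\<Sum>k | v k \<in> f \<and> (j, k) \<in> E_F T v. W T lam j k x \<bullet> (y - x))) / 2
     else 0)"
proof -
  have I: "W T lam i k x \<bullet> (y - x) = 0" if "(i, k) \<in> E_I T v" for i k
    using that W_outside[OF f] E_I_not_in_facet[OF f(1)] by blast
  have "Wt T v lam C i j x \<bullet> (y - x) = W T lam i j x \<bullet> (y - x)
      + ((\<Sum>k | k \<in> V_adj T v i j \<and> (i, k) \<in> E_F T v. W T lam i k x \<bullet> (y - x))
         - (\<Sum>k | k \<in> V_adj T v i j \<and> (j, k) \<in> E_F T v. W T lam j k x \<bullet> (y - x))) / 2"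
    by (simp add: Wt_def inner_add_left inner_diff_left inner_sum_left I)
  then show ?thesis
    using sum_V_adj_inner[OF f, of i j] sum_V_adj_inner[OF f, of j i]
    by (cases "v i \<in> f \<and> v j \<in> f") (use W_outside[OF f, of i j] in \<open>auto simp: V_adj_commute[of j i]\<close>)
qed

text \<open>The condition on the four vertices is invariant under cyclic rotation, so any vertex may
  be named first.\<close>

lemma parallelogram_at_vertex:
  assumes "is_parallelogram v f" "v k \<in> f"
  obtains b c d where "distinct [k, b, c, d]" "{k. v k \<in> f} = {k, b, c, d}" "v b - v k = v c - v d"
proof -
  obtain p q r s where pqrs: "distinct [p, q, r, s]" "{k. v k \<in> f} = {p, q, r, s}"
    "v q - v p = v r - v s"
    using assms(1) unfolding is_parallelogram_def by blast
  have rot: "v r - v q = v s - v p" "v s - v r = v p - v q" "v p - v s = v q - v r"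
    using pqrs(3) by (auto simp: algebra_simps)
  have "k \<in> {p, q, r, s}" using assms(2) pqrs(2) by blast
  then consider "k = p" | "k = q" | "k = r" | "k = s" by blast
  then show thesis
    by cases (use that[of q r s] that[of r s p] that[of s p q] that[of p q r] pqrs rot in auto)
qed

text \<open>The coordinates of the facet sum to 1 and their tangential gradients to 0.\<close>

lemma W_sum_facet:
  assumes f: "f \<in> faces T" "x \<in> f" "y \<in> f"
  shows "(\<Sum>i | v i \<in> f. W T lam i k x \<bullet> (y - x)) = grad T (lam k) x \<bullet> (y - x)"
proof -
  have "(\<Sum>i | v i \<in> f. W T lam i k x \<bullet> (y - x)) =
      (\<Sum>i | v i \<in> f. lam i x) * (grad T (lam k) x \<bullet> (y - x))
      - lam k x * (\<Sum>i | v i \<in> f. grad T (lam i) x \<bullet> (y - x))"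
    by (simp add: W_def inner_diff_left sum_subtractf sum_distrib_left sum_distrib_right)
  then show ?thesis using sum_lam[OF f(1,2)] sum_grad_lam[OF f] by simp
qed

text \<open>Reduces to \<open>W_sum_facet\<close>: the corrections in \<open>Wt\<close> must supply
  the term of the vertex of \<open>f\<close> that is opposite to \<open>k\<close>, if there is
  one.\<close>

lemma sum_Wt_facet:
  assumes f: "f \<in> faces T" "x \<in> f" "y \<in> f"
  shows "(\<Sum>i | (i, k) \<in> E T v. Wt T v lam C i k x \<bullet> (y - x)) = grad T (lam k) x \<bullet> (y - x)"
proof (cases "v k \<in> f")
  case False
  then show ?thesis using f by (simp add: Wt_facet grad_lam_outside)
next
  case k: True
  define w where "w i j = W T lam i j x \<bullet> (y - x)" for i j
  have w_swap: "w j i = - w i j" for i j by (simp add: w_def W_swap[of j i])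
  have w_self: "w i i = 0" for i using w_swap[of i i] by simp
  have wt: "Wt T v lam C i k x \<bullet> (y - x) = w i k
      + ((\<Sum>m | v m \<in> f \<and> (i, m) \<in> E_F T v. w i m)
         - (\<Sum>m | v m \<in> f \<and> (k, m) \<in> E_F T v. w k m)) / 2"
    if "(i, k) \<in> E T v" "v i \<in> f" for i
    using Wt_facet[OF f that(1)] that k by (simp add: w_def)
  have "(\<Sum>i | (i, k) \<in> E T v. Wt T v lam C i k x \<bullet> (y - x)) =
      (\<Sum>i | v i \<in> f \<and> (i, k) \<in> E T v. Wt T v lam C i k x \<bullet> (y - x))"
    using Wt_facet[OF f] by (intro sum.mono_neutral_right) auto
  also have "\<dots> = (\<Sum>i | v i \<in> f. w i k)"
  proof -
    have "is_triangle v f \<or> is_parallelogram v f"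
      using lam2 f by (simp add: assumption2_def)
    then show ?thesis
    proof
      assume tri: "is_triangle v f"
      have "(i, m) \<notin> E_F T v" if "v i \<in> f" "v m \<in> f" for i m
        using triangle_E[OF f(1) tri that] by (auto simp: E_F_def)
      then have no_F: "{m. v m \<in> f \<and> (i, m) \<in> E_F T v} = {}" if "v i \<in> f" for i
        using that by blast
      have "(\<Sum>i | v i \<in> f \<and> (i, k) \<in> E T v. Wt T v lam C i k x \<bullet> (y - x)) =
          (\<Sum>i | v i \<in> f \<and> (i, k) \<in> E T v. w i k)"
        using k by (intro sum.cong) (auto simp: wt no_F)
      \<comment> \<open>All vertices of the triangle except \<open>k\<close> are neighbours of
        \<open>k\<close>, and the added term \<open>w k k\<close> is zero.\<close>
      also have "\<dots> = (\<Sum>i | v i \<in> f. w i k)"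
        using triangle_E[OF f(1) tri _ k] w_self by (intro sum.mono_neutral_left) auto
      finally show ?thesis .
    next
      assume "is_parallelogram v f"
      then obtain b c d where K: "distinct [k, b, c, d]" "{k. v k \<in> f} = {k, b, c, d}"
        and par: "v b - v k = v c - v d"
        using parallelogram_at_vertex k by metis
      have in_f: "v i \<in> f \<longleftrightarrow> i \<in> {k, b, c, d}" for i using K(2) by blast
      have "(k, b) \<in> E T v" "(k, c) \<notin> E T v"
        using parallelogram_E[OF f(1) K par] by auto
      \<comment> \<open>Rotating the names turns each remaining side, and the second diagonal, into
        the first side and diagonal of \<open>parallelogram_E\<close>.\<close>
      moreover have "(b, c) \<in> E T v" "(b, d) \<notin> E T v"
        using parallelogram_E[of f b c d k] f(1) K par by (auto simp: algebra_simps insert_commute)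
      moreover have "(c, d) \<in> E T v"
        using parallelogram_E[of f c d k b] f(1) K par by (auto simp: algebra_simps insert_commute)
      moreover have "(d, k) \<in> E T v"
        using parallelogram_E[of f d k b c] f(1) K par by (auto simp: algebra_simps insert_commute)
      ultimately have edges: "(b, k) \<in> E T v" "(k, b) \<in> E T v" "(b, c) \<in> E T v" "(d, c) \<in> E T v"
        "(d, k) \<in> E T v" "(k, d) \<in> E T v" "(k, c) \<notin> E T v" "(c, k) \<notin> E T v"
        "(b, d) \<notin> E T v" "(d, b) \<notin> E T v"
        using E_commute by blast+
      have F: "(i, m) \<in> E_F T v \<longleftrightarrow> i \<noteq> m \<and> (i, m) \<notin> E T v"
        if "i \<in> {k, b, c, d}" "m \<in> {k, b, c, d}" for i m
        using E_F_iff_in_facet[OF f(1)] that in_f by (cases "i = m") (auto simp: E_F_def)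
      have "{i. v i \<in> f \<and> (i, k) \<in> E T v} = {b, d}"
        using edges E_irrefl by (auto simp: in_f)
      moreover have "{m. v m \<in> f \<and> (b, m) \<in> E_F T v} = {d}"
        using edges K(1) F[of b] by (auto simp: in_f)
      moreover have "{m. v m \<in> f \<and> (d, m) \<in> E_F T v} = {b}"
        using edges K(1) F[of d] by (auto simp: in_f)
      moreover have "{m. v m \<in> f \<and> (k, m) \<in> E_F T v} = {c}"
        using edges K(1) F[of k] by (auto simp: in_f)
      \<comment> \<open>The halves \<open>w b d / 2\<close> and \<open>w d b / 2\<close> cancel,
        while the two halves of \<open>- w k c\<close> add up to the missing term
        \<open>w c k\<close>.\<close>
      ultimately show ?thesis
        using K edges in_f w_swap[of b d] w_swap[of k c] w_self by (simp add: wt field_simps)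
    qed
  qed
  also have "\<dots> = grad T (lam k) x \<bullet> (y - x)"
    unfolding w_def by (rule W_sum_facet[OF f])
  finally show ?thesis .
qed

section \<open>Traces of the fields of the space\<close>

lemma MLambda1_facet:
  assumes q: "q \<in> MLambda1 T v lam C"
  obtains \<beta> where "\<And>f x y. f \<in> faces T \<Longrightarrow> x \<in> f \<Longrightarrow> y \<in> f \<Longrightarrow>
    q x \<bullet> (y - x) = (\<Sum>(i, j)\<in>E T v. \<beta> (i, j) * (Wt T v lam C i j x \<bullet> (y - x)))"
proof -
  obtain a c where ac: "\<And>x. x \<in> T \<Longrightarrow> q x = (\<Sum>i\<in>UNIV. a i *\<^sub>R grad T (lam i) x)
      + (\<Sum>f\<in>faces T. c f *\<^sub>R Wt_face T v lam C f x)"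
    using q unfolding MLambda1_def by blast
  \<comment> \<open>The gradient of \<open>lam k\<close> spreads \<open>a k\<close> over the edges
    ending in \<open>k\<close>, hence \<open>snd\<close>; \<open>c g\<close> goes to the oriented
    boundary edges of \<open>g\<close>. Nothing here depends on the facet of evaluation.\<close>
  define \<beta> where "\<beta> e = a (snd e) + (\<Sum>g | g \<in> faces T \<and> e \<in> bdry_edges T v g. c g)" for e
  have "q x \<bullet> (y - x) = (\<Sum>(i, j)\<in>E T v. \<beta> (i, j) * (Wt T v lam C i j x \<bullet> (y - x)))"
    if f: "f \<in> faces T" "x \<in> f" "y \<in> f" for f x y
  proof -
    define wt where "wt e = Wt T v lam C (fst e) (snd e) x \<bullet> (y - x)" for e
    have "(\<Sum>k\<in>UNIV. a k *\<^sub>R grad T (lam k) x) \<bullet> (y - x) =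
        (\<Sum>k\<in>UNIV. \<Sum>i | (i, k) \<in> E T v. a k * wt (i, k))"
      by (simp add: inner_sum_left wt_def flip: sum_Wt_facet[OF f] sum_distrib_left)
    \<comment> \<open>The outer index is the terminal vertex, so the pairs appear reversed at
      first.\<close>
    also have "\<dots> = (\<Sum>(k, i)\<in>(E T v)\<inverse>. a k * wt (i, k))"
      by (subst sum.Sigma) (auto intro!: sum.cong)
    also have "\<dots> = (\<Sum>e\<in>E T v. a (snd e) * wt e)"
      by (rule sum.reindex_bij_witness[of _ prod.swap prod.swap]) auto
    finally have 1: "(\<Sum>k\<in>UNIV. a k *\<^sub>R grad T (lam k) x) \<bullet> (y - x) =
        (\<Sum>e\<in>E T v. a (snd e) * wt e)" .
    have "(\<Sum>g\<in>faces T. c g *\<^sub>R Wt_face T v lam C g x) \<bullet> (y - x) =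
        (\<Sum>g\<in>faces T. \<Sum>e | e \<in> E T v \<and> e \<in> bdry_edges T v g. c g * wt e)"
      using bdry_edges_subset_E
      by (auto simp: Wt_face_def inner_sum_left sum_distrib_left wt_def split_def intro!: sum.cong)
    also have "\<dots> = (\<Sum>e\<in>E T v. \<Sum>g | g \<in> faces T \<and> e \<in> bdry_edges T v g. c g * wt e)"
      by (rule sum.swap_restrict) (auto simp: finite_faces)
    finally show ?thesis
      using f facetD(3)[OF f(1)] 1
      by (auto simp: ac inner_add_left \<beta>_def wt_def split_def distrib_right sum_distrib_right
          sum.distrib)
  qed
  then show thesis by (rule that)
qed

text \<open>\<open>E\<close> contains both directions of each edge and \<open>Wt\<close> is
  antisymmetric, so only the differences of opposite coefficients matter; the values of
  \<open>q\<close> at the initial vertices determine them.\<close>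

lemma basis_trace:
  assumes q: "q \<in> MLambda1 T v lam C" and Ep: "edge_selection T v Ep" and ij: "(i, j) \<in> Ep"
    and edges: "\<And>e. e \<in> Ep \<Longrightarrow> q (v (fst e)) \<bullet> unit_tangent v e = (if e = (i, j) then 1 else 0)"
    and f: "f \<in> faces T" "x \<in> f" "y \<in> f"
  shows "q x \<bullet> (y - x) = edge_length v (i, j) * (Wt T v lam C i j x \<bullet> (y - x))"
proof -
  obtain \<beta> where \<beta>: "\<And>f x y. f \<in> faces T \<Longrightarrow> x \<in> f \<Longrightarrow> y \<in> f \<Longrightarrow>
      q x \<bullet> (y - x) = (\<Sum>(i, j)\<in>E T v. \<beta> (i, j) * (Wt T v lam C i j x \<bullet> (y - x)))"
    using MLambda1_facet[OF q] by blast
  let ?l = "edge_length v (i, j)"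
  have EpE: "Ep \<subseteq> E T v" and Ep1: "\<And>a b. (a, b) \<in> E T v \<Longrightarrow> (a, b) \<in> Ep \<longleftrightarrow> (b, a) \<notin> Ep"
    using Ep unfolding edge_selection_def by auto
  have jump: "\<beta> (a, b) - \<beta> (b, a) = ?l * (of_bool ((a, b) = (i, j)) - of_bool ((b, a) = (i, j)))"
    if ab: "(a, b) \<in> Ep" for a b
  proof -
    have abE: "(a, b) \<in> E T v" "(b, a) \<in> E T v" "a \<noteq> b" and "(b, a) \<notin> Ep"
      using ab EpE Ep1 E_commute E_irrefl by blast+
    obtain g where g: "g \<in> faces T" "v a \<in> g" "v b \<in> g"
      using E_subset_facet[OF abE(1)] .
    have "q (v a) \<bullet> (v b - v a) = edge_length v (a, b) * (q (v a) \<bullet> unit_tangent v (a, b))"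
      using abE(3) by (simp add: unit_tangent_def tau_def edge_length_def)
    \<comment> \<open>The dual value is 0 except on \<open>(i, j)\<close>, so the length of that
      edge may stand for the length of every edge.\<close>
    also have "\<dots> = ?l * of_bool ((a, b) = (i, j))"
      using edges[OF ab] by auto
    finally have "?l * of_bool ((a, b) = (i, j)) = q (v a) \<bullet> (v b - v a)" ..
    also have "\<dots> = (\<Sum>e\<in>E T v. \<beta> e * (of_bool (e = (a, b)) - of_bool (e = (b, a))))"
      unfolding \<beta>[OF g]
      by (intro sum.cong) (auto simp: Wt_vertex[OF abE(1)])
    also have "\<dots> = \<beta> (a, b) - \<beta> (b, a)"
      by (rule sum_of_bool_diff) (use abE in simp_all)
    finally have "?l * of_bool ((a, b) = (i, j)) = \<beta> (a, b) - \<beta> (b, a)" .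
    \<comment> \<open>\<open>Ep\<close> contains only one direction of each edge, so the second
      indicator is 0.\<close>
    moreover have "(b, a) \<noteq> (i, j)" using \<open>(b, a) \<notin> Ep\<close> ij by metis
    ultimately show ?thesis by (simp only: of_bool_eq diff_zero)
  qed
  \<comment> \<open>Reversing an edge negates both sides, which extends the formula from
    \<open>Ep\<close> to all of \<open>E T v\<close>.\<close>
  have jump': "\<beta> (a, b) - \<beta> (b, a) = ?l * (of_bool ((a, b) = (i, j)) - of_bool ((b, a) = (i, j)))"
    if "(a, b) \<in> E T v" for a b
  proof (cases "(a, b) \<in> Ep")
    case True
    then show ?thesis by (rule jump)
  next
    case False
    then have "(b, a) \<in> Ep" using Ep1[OF that] by blast
    from jump[OF this] show ?thesis by argo
  qed
  define wt where "wt a b = Wt T v lam C a b x \<bullet> (y - x)" for a b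
  have wt_swap: "wt b a = - wt a b" for a b
    by (simp add: wt_def Wt_swap[of b a])
  have antisym: "\<beta> (a, b) * wt a b + \<beta> (b, a) * wt b a = (\<beta> (a, b) - \<beta> (b, a)) * wt a b" for a b
    unfolding wt_swap[of b a] by (simp add: algebra_simps)
  have ijE: "(i, j) \<in> E T v" "(j, i) \<in> E T v" using ij EpE E_commute by blast+
  \<comment> \<open>Adding the sum to its copy over reversed edges brings in the coefficient
    differences, at the price of a factor 2.\<close>
  have "(\<Sum>(a, b)\<in>E T v. \<beta> (a, b) * wt a b) = (\<Sum>(a, b)\<in>E T v. \<beta> (b, a) * wt b a)"
    by (rule sum.reindex_bij_witness[of _ prod.swap prod.swap]) (auto simp: E_commute)
  then have "2 * (q x \<bullet> (y - x)) = (\<Sum>(a, b)\<in>E T v. \<beta> (a, b) * wt a b)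
      + (\<Sum>(a, b)\<in>E T v. \<beta> (b, a) * wt b a)"
    using \<beta>[OF f] by (simp add: wt_def)
  also have "\<dots> = (\<Sum>(a, b)\<in>E T v. (\<beta> (a, b) - \<beta> (b, a)) * wt a b)"
    unfolding sum.distrib[symmetric]
    by (simp only: split_def antisym)
  also have "\<dots> = (\<Sum>e\<in>E T v. ?l * wt (fst e) (snd e) * (of_bool (e = (i, j)) - of_bool (e = (j, i))))"
  proof (rule sum.cong[OF refl])
    fix e assume "e \<in> E T v"
    then obtain a b where e: "e = (a, b)" "(a, b) \<in> E T v" by (cases e) auto
    have swap: "(b, a) = (i, j) \<longleftrightarrow> (a, b) = (j, i)" by auto
    show "(case e of (a, b) \<Rightarrow> (\<beta> (a, b) - \<beta> (b, a)) * wt a b)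
        = ?l * wt (fst e) (snd e) * (of_bool (e = (i, j)) - of_bool (e = (j, i)))"
      unfolding e(1) prod.case jump'[OF e(2)] swap fst_conv snd_conv by (simp only: ac_simps)
  qed
  also have "\<dots> = ?l * wt i j - ?l * wt j i"
    using sum_of_bool_diff[of "E T v" "(i, j)" "(j, i)" "\<lambda>e. ?l * wt (fst e) (snd e)"] ijE by simp
  also have "\<dots> = 2 * (?l * wt i j)"
    by (simp add: wt_swap[of j i])
  finally show ?thesis by (simp add: wt_def)
qed

text \<open>The difference of the two fields is orthogonal to the plane of \<open>f\<close>, so it
  is a multiple of the normal and is removed by the projection.\<close>

lemma tang_trace_eqI:
  assumes f: "f \<in> faces T" and eq: "\<And>x y. x \<in> f \<Longrightarrow> y \<in> f \<Longrightarrow> p x \<bullet> (y - x) = q x \<bullet> (y - x)"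
  shows "tang_trace T f p = tang_trace T f q"
proof -
  let ?n = "outward_normal T f"
  note n = outward_normal_facet[OF polytope_imp_polyhedron[OF polytope_T] aff_dim_T facetD(1)[OF f]]
  have "p x - (p x \<bullet> ?n) *\<^sub>R ?n = q x - (q x \<bullet> ?n) *\<^sub>R ?n" if x: "x \<in> f" for x
  proof -
    have "p x - q x = ((p x - q x) \<bullet> ?n) *\<^sub>R ?n"
      by (rule orthogonal_facet[OF facetD(4)[OF f] n x]) (simp_all add: inner_diff_left eq x)
    then show ?thesis by (simp add: algebra_simps inner_diff_left)
  qed
  then show ?thesis unfolding tang_trace_def by (simp add: restrict_def fun_eq_iff)
qed

end

theorem lemma4p11:
  fixes T :: "(real^3) set"
    and v :: "'n::finite \<Rightarrow> real^3"
    and lam :: "'n \<Rightarrow> real^3 \<Rightarrow> real"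
    and C :: "'n \<Rightarrow> 'n \<Rightarrow> 'n \<Rightarrow> real"
    and Ep :: "('n \<times> 'n) set"
    and p :: "'n \<times> 'n \<Rightarrow> real^3 \<Rightarrow> real^3"
    and i j :: 'n
  assumes "convex_polyhedron T v"
    and "gen_barycentric T UNIV v lam"
    and "assumption1 T v lam"
    and "assumption2 T v lam"
    and "interior_coeffs T v C"
    and "edge_selection T v Ep"
    and "edge_basis T v lam C Ep p"
    and "(i, j) \<in> Ep"
  shows "bdry_tang_trace T (p (i, j))
       = bdry_tang_trace T (\<lambda>x. edge_length v (i, j) *\<^sub>R Wt T v lam C i j x)"
proof -
  interpret barycentric_polyhedron T v lam C
    using assms by unfold_locales
  have p: "p (i, j) \<in> MLambda1 T v lam C"
    using assms(7,8) by (auto simp: edge_basis_def basis_on_def)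
  \<comment> \<open>The duality is evaluated at the initial vertex, a point of the closed
    segment.\<close>
  have edges: "p (i, j) (v (fst e)) \<bullet> unit_tangent v e = (if e = (i, j) then 1 else 0)"
    if "e \<in> Ep" for e
    using assms(7,8) that unfolding edge_basis_def by fastforce
  have "tang_trace T f (p (i, j)) =
      tang_trace T f (\<lambda>x. edge_length v (i, j) *\<^sub>R Wt T v lam C i j x)" if "f \<in> faces T" for f
    using basis_trace[OF p assms(6,8) edges that] by (intro tang_trace_eqI that) simp
  then show ?thesis
    unfolding bdry_tang_trace_def by (simp add: restrict_def fun_eq_iff)
qed

end
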